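(* Let $d\ge1$, let $\Lambda\subset\mathbb{R}^{2d}$ be a lattice, let $r>0$ and let $g\in M^*_\Lambda(\mathbb{R}^d)$ be such that $(g,\Lambda)$ induces a tight frame with frame constant $1$ and $$|V_gg(z)|\le C(1+|z|)^{-s}\ \text{ for all } z\in\mathbb{R}^{2d},\qquad V_gg(\lambda)\ne0\ \text{ for }\lambda\in\Lambda\cap B(0,r+3l_M)$$ for some $C>0$ and $s>2d+1$, where $l_M$ is the diameter of the fundamental domain of $\Lambda$. Then there exist constants $C_1,C_2$ depending only on $g$, $\Lambda$ and $r$ such that $$C_1\,\#\partial^{r_\Lambda}_\Lambda B(0,R)\le\Vert\rho_{B(0,R)}-\chi_{B(0,R)}\Vert_{\ell^1(\Lambda)}\le C_2\,\#\partial^{r_\Lambda}_\Lambda B(0,R)$$ for all $R>0$, where $r_\Lambda=r+l_M$.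
   Context: For $z=(x,\omega)\in\mathbb{R}^{2d}$ the time-frequency shift $\pi(z)$ acts on $L^2(\mathbb{R}^d)$ by $\pi(x,\omega)f(t)=e^{2\pi i\omega\cdot t}f(t-x)$, and the short-time Fourier transform with window $g\in L^2(\mathbb{R}^d)$ is $V_gf(z)=\langle f,\pi(z)g\rangle$. A lattice is $\Lambda=M\mathbb{Z}^{2d}$ with $M$ an invertible real $2d\times 2d$ matrix; $l_M$ denotes the diameter of the (fixed) fundamental domain of $\Lambda$. $(g,\Lambda)$ induces a tight frame with frame constant $1$ if $\sum_{\lambda\in\Lambda}|\langle f,\pi(\lambda)g\rangle|^2=\Vert f\Vert_{L^2}^2$ for all $f\in L^2(\mathbb{R}^d)$. The space $M^*_\Lambda(\mathbb{R}^d)$ consists of $g\in L^2(\mathbb{R}^d)$ with $\Vert g\Vert_{M^*_\Lambda}=\big(\sum_{\lambda\in\Lambda}|\lambda|\,|V_gg(\lambda)|^2\big)^{1/2}<\infty$. For compact $\Omega\subset\mathbb{R}^{2d}$ the Gabor multiplier is $G^g_{\Omega,\Lambda}f=\sum_{\lambda\in\Lambda}\chi_\Omega(\lambda)V_gf(\lambda)\pi(\lambda)g$; it is a finite-rank positive self-adjoint operator with eigendecomposition $G^g_{\Omega,\Lambda}=\sum_{k=1}^\infty\lambda_k^\Omega\,\langle\cdot,h_k^\Omega\rangle h_k^\Omega$, where $(h_k^\Omega)_{k\ge1}$ is an orthonormal basis of $L^2(\mathbb{R}^d)$ and $\lambda_1^\Omega\ge\lambda_2^\Omega\ge\dots\ge0$.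 The accumulated spectrogram (here with frame bound $B=1$) is $\rho_\Omega(\lambda)=\frac{1}{\Vert g\Vert_{L^2}^2}\sum_{k=1}^{A_\Omega}|V_gh_k^\Omega(\lambda)|^2$ for $\lambda\in\Lambda$, with $A_\Omega=\lceil\#(\Omega\cap\Lambda)\Vert g\Vert_{L^2}^2\rceil$. For $r>0$, $\partial^r_\Lambda\Omega=\Lambda\cap(\partial\Omega+B(0,r))$, where $B(z,r)$ is the open ball and $\#$ denotes cardinality. $\Vert c\Vert_{\ell^1(\Lambda)}=\sum_{\lambda\in\Lambda}|c(\lambda)|$. *)

theory Defs
  imports "HOL-Analysis.Analysis"
begin

text \<open>Phase space R^{2d} is modelled as (real^'n) \<times> (real^'n), z = (x, omega),
  with the product (Euclidean) norm. d = CARD('n).\<close>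

type_synonym 'n phase = "(real^'n) \<times> (real^'n)"

definition L2 :: "(real^'n::finite \<Rightarrow> complex) set" where
  "L2 = {f. f \<in> borel_measurable lebesgue \<and> integrable lebesgue (\<lambda>t. (cmod (f t))^2)}"

definition inner_L2 :: "(real^'n::finite \<Rightarrow> complex) \<Rightarrow> (real^'n \<Rightarrow> complex) \<Rightarrow> complex" where
  "inner_L2 f h = (LINT t|lebesgue. f t * cnj (h t))"

definition norm_L2 :: "(real^'n::finite \<Rightarrow> complex) \<Rightarrow> real" where
  "norm_L2 f = sqrt (LINT t|lebesgue. (cmod (f t))^2)"

definition tfshift :: "'n::finite phase \<Rightarrow> (real^'n \<Rightarrow> complex) \<Rightarrow> (real^'n \<Rightarrow> complex)" where
  "tfshift z f = (\<lambda>t. exp (2 * complex_of_real pi * \<i> * complex_of_real (snd z \<bullet> t)) * f (t - fst z))"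

definition stft :: "(real^'n::finite \<Rightarrow> complex) \<Rightarrow> (real^'n \<Rightarrow> complex) \<Rightarrow> 'n phase \<Rightarrow> complex" where
  "stft g f z = inner_L2 f (tfshift z g)"

definition int_points :: "'n::finite phase set" where
  "int_points = {z. \<forall>i. fst z $ i \<in> \<int> \<and> snd z $ i \<in> \<int>}"

definition lattice :: "('n::finite phase \<Rightarrow> 'n phase) \<Rightarrow> 'n phase set" where
  "lattice M = M ` int_points"

definition fund_domain :: "('n::finite phase \<Rightarrow> 'n phase) \<Rightarrow> 'n phase set" where
  "fund_domain M = M ` {z. \<forall>i. fst z $ i \<in> {0..<1} \<and> snd z $ i \<in> {0..<1}}"

definition lM :: "('n::finite phase \<Rightarrow> 'n phase) \<Rightarrow> real" where
  "lM M = diameter (fund_domain M)"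

definition tight_frame1 :: "(real^'n::finite \<Rightarrow> complex) \<Rightarrow> 'n phase set \<Rightarrow> bool" where
  "tight_frame1 g \<Lambda> \<longleftrightarrow> (\<forall>f\<in>L2. ((\<lambda>l. (cmod (stft g f l))^2) has_sum (norm_L2 f)^2) \<Lambda>)"

definition Mstar :: "'n::finite phase set \<Rightarrow> (real^'n \<Rightarrow> complex) set" where
  "Mstar \<Lambda> = {g \<in> L2. (\<lambda>l. norm l * (cmod (stft g g l))^2) summable_on \<Lambda>}"

text \<open>Gabor multiplier G^g_{Omega,Lambda} f = sum over lambda in Lambda of chi_Omega(lambda) V_g f(lambda) pi(lambda) g
  (a finite sum for bounded Omega).\<close>
definition gabor_mult :: "(real^'n::finite \<Rightarrow> complex) \<Rightarrow> 'n phase set \<Rightarrow> 'n phase set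
    \<Rightarrow> (real^'n \<Rightarrow> complex) \<Rightarrow> (real^'n \<Rightarrow> complex)" where
  "gabor_mult g \<Lambda> \<Omega> f = (\<lambda>t. \<Sum>l\<in>\<Lambda> \<inter> \<Omega>. stft g f l * tfshift l g t)"

definition ONB_L2 :: "(nat \<Rightarrow> (real^'n::finite \<Rightarrow> complex)) \<Rightarrow> bool" where
  "ONB_L2 h \<longleftrightarrow> (\<forall>k. h k \<in> L2)
     \<and> (\<forall>j k. inner_L2 (h j) (h k) = (if j = k then 1 else 0))
     \<and> (\<forall>f\<in>L2. (\<forall>k. inner_L2 f (h k) = 0) \<longrightarrow> norm_L2 f = 0)"

text \<open>Eigendecomposition G = sum_k ev k <., h k> h k with (h k) an ONB of eigenvectors
  and non-increasing non-negative eigenvalues (equalities in L2, i.e. almost everywhere).\<close>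
definition eigendecomp :: "((real^'n::finite \<Rightarrow> complex) \<Rightarrow> (real^'n \<Rightarrow> complex))
    \<Rightarrow> (nat \<Rightarrow> (real^'n \<Rightarrow> complex)) \<Rightarrow> (nat \<Rightarrow> real) \<Rightarrow> bool" where
  "eigendecomp G h ev \<longleftrightarrow> ONB_L2 h \<and> antimono ev \<and> (\<forall>k. ev k \<ge> 0)
     \<and> (\<forall>k. AE t in lebesgue. G (h k) t = complex_of_real (ev k) * h k t)"

definition A_Omega :: "(real^'n::finite \<Rightarrow> complex) \<Rightarrow> 'n phase set \<Rightarrow> 'n phase set \<Rightarrow> nat" where
  "A_Omega g \<Lambda> \<Omega> = nat \<lceil>real (card (\<Omega> \<inter> \<Lambda>)) * (norm_L2 g)^2\<rceil>"

definition acc_spec :: "(real^'n::finite \<Rightarrow> complex) \<Rightarrow> 'n phase set \<Rightarrow> 'n phase set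
    \<Rightarrow> (nat \<Rightarrow> (real^'n \<Rightarrow> complex)) \<Rightarrow> 'n phase \<Rightarrow> real" where
  "acc_spec g \<Lambda> \<Omega> h l = (1 / (norm_L2 g)^2) * (\<Sum>k<A_Omega g \<Lambda> \<Omega>. (cmod (stft g (h k) l))^2)"

definition l1_norm :: "'n::finite phase set \<Rightarrow> ('n phase \<Rightarrow> real) \<Rightarrow> real" where
  "l1_norm \<Lambda> c = (\<Sum>\<^sub>\<infinity>l\<in>\<Lambda>. \<bar>c l\<bar>)"

definition disc_boundary :: "'n::finite phase set \<Rightarrow> real \<Rightarrow> 'n phase set \<Rightarrow> 'n phase set" where
  "disc_boundary \<Lambda> r \<Omega> = \<Lambda> \<inter> {a + b | a b. a \<in> frontier \<Omega> \<and> b \<in> ball 0 r}"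

end

theory Submission
  imports Defs
begin

text \<open>Let \<open>b = \<parallel>g\<parallel>\<^sup>2\<close>, let \<open>\<Omega>\<close> be the ball, let \<open>F = |V\<^sub>g g|\<^sup>2\<close> and let \<open>\<lambda>\<^sub>k\<close> be the eigenvalues of the Gabor
  multiplier. Since \<open>0 \<le> \<rho> \<le> 1\<close> and all series can be summed by the tight frame identity, \<open>b\<close> times the
  \<open>l1\<close> error equals \<open>(\<Sum>k<A. 1 - \<lambda>\<^sub>k) + (\<Sum>k\<ge>A. \<lambda>\<^sub>k)\<close>. The two sums differ by less than 1, so, by monotonicity
  of the eigenvalues, this lies between \<open>P\<close> and \<open>4 P + 1\<close>, where \<open>P = \<Sum>k. \<lambda>\<^sub>k (1 - \<lambda>\<^sub>k)\<close> is the trace of \<open>G - G\<^sup>2\<close>.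
  Computing this trace from the Gram matrix of the \<open>\<pi>(\<lambda>)g\<close>, and using the tight frame identity for \<open>\<pi>(\<lambda>)g\<close>,
  \<open>P\<close> is the sum over \<open>v \<in> \<Lambda>\<close> of \<open>F(v)\<close> times the number of lattice points of \<open>\<Omega>\<close> that the shift by \<open>v\<close>
  moves out of \<open>\<Omega>\<close>. From above, this number is at most a constant times \<open>1 + |v|\<close> times the size of the
  discrete boundary, and \<open>g \<in> M\<^sup>*\<close> makes the sum over \<open>v\<close> converge. From below, every point of the discrete
  boundary has a lattice point on the other side of the sphere at distance less than \<open>r + 3 l\<^sub>M\<close>, where \<open>F\<close> is
  bounded below.\<close>

section \<open>Square-integrable functions and time-frequency shifts\<close>

lemma L2_measurable: "f \<in> L2 \<Longrightarrow> f \<in> borel_measurable lebesgue"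
  by (simp add: L2_def)

lemma L2_integrable_square: "f \<in> L2 \<Longrightarrow> integrable lebesgue (\<lambda>t. (cmod (f t))^2)"
  by (simp add: L2_def)

lemma L2_integrable_mult:
  assumes "f \<in> L2" "h \<in> L2"
  shows "integrable lebesgue (\<lambda>t. f t * cnj (h t))"
proof (rule Bochner_Integration.integrable_bound)
  show "integrable lebesgue (\<lambda>t. (cmod (f t))^2 + (cmod (h t))^2)"
    using assms by (intro Bochner_Integration.integrable_add L2_integrable_square)
  have [measurable]: "f \<in> borel_measurable lebesgue" "h \<in> borel_measurable lebesgue"
    using assms by (auto intro: L2_measurable)
  have [measurable]: "cnj \<in> borel_measurable borel"
    by (intro borel_measurable_continuous_onI continuous_intros)
  show "(\<lambda>t. f t * cnj (h t)) \<in> borel_measurable lebesgue"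
    by measurable
  have "cmod (f t) * cmod (h t) \<le> (cmod (f t))^2 + (cmod (h t))^2" for t
    using sum_squares_bound[of "cmod (f t)" "cmod (h t)"]
      mult_nonneg_nonneg[OF norm_ge_zero norm_ge_zero, of "f t" "h t"] by linarith
  then show "AE t in lebesgue. norm (f t * cnj (h t)) \<le> norm ((cmod (f t))^2 + (cmod (h t))^2)"
    by (simp add: norm_mult)
qed

lemma L2_add:
  assumes "f \<in> L2" "h \<in> L2"
  shows "(\<lambda>t. f t + h t) \<in> L2"
proof -
  have [measurable]: "f \<in> borel_measurable lebesgue" "h \<in> borel_measurable lebesgue"
    using assms by (auto intro: L2_measurable)
  have "integrable lebesgue (\<lambda>t. (cmod (f t + h t))^2)"
  proof (rule Bochner_Integration.integrable_bound)
    show "integrable lebesgue (\<lambda>t. 2 * (cmod (f t))^2 + 2 * (cmod (h t))^2)"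
      using assms by (intro Bochner_Integration.integrable_add integrable_mult_right L2_integrable_square)
    show "(\<lambda>t. (cmod (f t + h t))^2) \<in> borel_measurable lebesgue"
      by measurable
    have "(cmod (f t + h t))^2 \<le> 2 * (cmod (f t))^2 + 2 * (cmod (h t))^2" for t
    proof -
      have "(cmod (f t + h t))^2 \<le> (cmod (f t) + cmod (h t))^2"
        by (intro power_mono norm_triangle_ineq) auto
      then show ?thesis
        using sum_squares_bound[of "cmod (f t)" "cmod (h t)"] by (simp add: power2_sum)
    qed
    then show "AE t in lebesgue. norm ((cmod (f t + h t))^2)
        \<le> norm (2 * (cmod (f t))^2 + 2 * (cmod (h t))^2)"
      by simp
  qed
  then show ?thesis by (simp add: L2_def)
qed

lemma L2_scale:
  assumes "f \<in> L2"
  shows "(\<lambda>t. c * f t) \<in> L2"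
  using assms by (auto simp: L2_def norm_mult power_mult_distrib)

lemma L2_zero: "(\<lambda>t. 0) \<in> L2"
  by (simp add: L2_def)

lemma L2_sum:
  assumes "\<And>i. i \<in> I \<Longrightarrow> f i \<in> L2"
  shows "(\<lambda>t. \<Sum>i\<in>I. f i t) \<in> L2"
  using assms by (induction I rule: infinite_finite_induct) (auto simp: L2_zero intro: L2_add)

lemma inner_L2_scale_left: "inner_L2 (\<lambda>t. c * f t) h = c * inner_L2 f h"
  by (simp add: inner_L2_def mult.assoc)

lemma inner_L2_sum_left:
  assumes "\<And>i. i \<in> I \<Longrightarrow> f i \<in> L2" "h \<in> L2"
  shows "inner_L2 (\<lambda>t. \<Sum>i\<in>I. f i t) h = (\<Sum>i\<in>I. inner_L2 (f i) h)"
  unfolding inner_L2_def sum_distrib_right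
  using assms by (intro Bochner_Integration.integral_sum L2_integrable_mult)

lemma inner_L2_diff_left:
  assumes "f \<in> L2" "f' \<in> L2" "h \<in> L2"
  shows "inner_L2 (\<lambda>t. f t - f' t) h = inner_L2 f h - inner_L2 f' h"
  unfolding inner_L2_def left_diff_distrib
  using assms by (intro Bochner_Integration.integral_diff L2_integrable_mult)

lemma cnj_inner_L2: "cnj (inner_L2 f h) = inner_L2 h f"
proof -
  have "cnj (inner_L2 f h) = (LINT t|lebesgue. cnj (f t * cnj (h t)))"
    unfolding inner_L2_def by (rule Bochner_Integration.integral_cnj[symmetric])
  then show ?thesis
    by (simp add: inner_L2_def mult.commute)
qed

lemma norm_L2_square: "(norm_L2 f)^2 = (LINT t|lebesgue. (cmod (f t))^2)"
  unfolding norm_L2_def by (intro real_sqrt_pow2 integral_nonneg_AE) simp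

lemma inner_L2_same: "inner_L2 f f = complex_of_real ((norm_L2 f)^2)"
  unfolding inner_L2_def norm_L2_square
  by (simp add: complex_norm_square[symmetric] flip: integral_complex_of_real)

lemma inner_L2_cong_AE:
  assumes "AE t in lebesgue. f t = f' t" "f \<in> L2" "f' \<in> L2" "h \<in> L2"
  shows "inner_L2 f h = inner_L2 f' h"
  unfolding inner_L2_def
proof (rule integral_cong_AE)
  show "AE t in lebesgue. f t * cnj (h t) = f' t * cnj (h t)"
    using assms(1) by eventually_elim simp
qed (use assms in \<open>auto intro!: borel_measurable_integrable L2_integrable_mult\<close>)

text \<open>Elements of \<open>L2\<close> are functions, not classes; this lets a function of norm 0
  be treated as 0 inside inner products.\<close>

lemma inner_L2_null_left:
  assumes "norm_L2 f = 0" "f \<in> L2" "h \<in> L2"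
  shows "inner_L2 f h = 0"
proof -
  have "(LINT t|lebesgue. (cmod (f t))^2) = 0"
    using assms(1) by (simp flip: norm_L2_square)
  then have "AE t in lebesgue. (cmod (f t))^2 = 0"
    using L2_integrable_square[OF assms(2)] by (subst (asm) integral_nonneg_eq_0_iff_AE) auto
  then have "AE t in lebesgue. f t = (\<lambda>t. 0) t"
    by eventually_elim simp
  then have "inner_L2 f h = inner_L2 (\<lambda>t. 0) h"
    using assms L2_zero by (intro inner_L2_cong_AE)
  then show ?thesis
    by (simp add: inner_L2_def)
qed

section \<open>Translation invariance and time-frequency shifts\<close>

lemma distr_lebesgue_translation:
  fixes x :: "real^'n::finite"
  shows "(\<lambda>t. t - x) \<in> lebesgue \<rightarrow>\<^sub>M lebesgue" "distr lebesgue lebesgue (\<lambda>t. t - x) = lebesgue"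
proof -
  \<comment> \<open>The translation as an affine map with all scale factors 1, so that the density
    relating \<open>lebesgue\<close> to its image is 1.\<close>
  have *: "(\<lambda>t. - x + (\<Sum>j\<in>Basis. (1 * (t \<bullet> j)) *\<^sub>R j)) = (\<lambda>t. t - x)"
    by (simp add: euclidean_representation)
  show "(\<lambda>t. t - x) \<in> lebesgue \<rightarrow>\<^sub>M lebesgue"
    using lebesgue_affine_measurable[of "\<lambda>_. 1" "-x"] unfolding * by simp
  show "distr lebesgue lebesgue (\<lambda>t. t - x) = lebesgue"
    using lebesgue_affine_euclidean[of "\<lambda>_. 1" "-x"] unfolding * by (simp add: density_1)
qed

lemma tfshift_L2:
  assumes "g \<in> L2"
  shows "tfshift z g \<in> L2"
proof -
  note [measurable] = L2_measurable[OF assms] distr_lebesgue_translation(1)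
  have "integrable (distr lebesgue lebesgue (\<lambda>t. t - fst z)) (\<lambda>t. (cmod (g t))^2)"
    using L2_integrable_square[OF assms] by (simp add: distr_lebesgue_translation)
  then have "integrable lebesgue (\<lambda>t. (cmod (g (t - fst z)))^2)"
    by (subst (asm) integrable_distr_eq) auto
  moreover have "cmod (tfshift z g t) = cmod (g (t - fst z))" for t
    by (simp add: tfshift_def norm_mult)
  moreover have "tfshift z g \<in> borel_measurable lebesgue"
  proof -
    have "(\<lambda>t. exp (2 * complex_of_real pi * \<i> * complex_of_real (snd z \<bullet> t))) \<in> borel_measurable borel"
      by (intro borel_measurable_continuous_onI continuous_intros)
    then have "(\<lambda>t. exp (2 * complex_of_real pi * \<i> * complex_of_real (snd z \<bullet> t))) \<in> borel_measurable lebesgue"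
      by (intro measurable_completion) simp
    then show ?thesis
      unfolding tfshift_def by measurable
  qed
  ultimately show ?thesis
    by (simp add: L2_def)
qed

lemma integral_lebesgue_translation:
  fixes F :: "real^'n::finite \<Rightarrow> complex"
  assumes "F \<in> borel_measurable lebesgue"
  shows "(LINT t|lebesgue. F (t - x)) = (LINT t|lebesgue. F t)"
  using integral_distr[OF distr_lebesgue_translation(1)[of x] assms]
  by (simp add: distr_lebesgue_translation)

text \<open>Up to a unimodular factor, \<open>\<pi>(l)\<^sup>* \<pi>(m)\<close> is \<open>\<pi>(m - l)\<close>.\<close>

lemma norm_inner_tfshift:
  assumes "g \<in> L2"
  shows "cmod (inner_L2 (tfshift l g) (tfshift m g)) = cmod (stft g g (m - l))"
proof -
  define c where "c = cis (2 * pi * ((snd l - snd m) \<bullet> fst l))"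
  let ?F = "\<lambda>t. g t * cnj (tfshift (m - l) g t)"
  have c: "cmod c = 1"
    by (simp add: c_def)
  have tfshift: "tfshift z g t = cis (2 * pi * (snd z \<bullet> t)) * g (t - fst z)" for z t
    by (simp add: tfshift_def cis_conv_exp mult_ac)
  have "tfshift l g t * cnj (tfshift m g t) = c * ?F (t - fst l)" for t
  proof -
    have "tfshift l g t * cnj (tfshift m g t)
        = cis (2 * pi * (snd l \<bullet> t)) * cnj (cis (2 * pi * (snd m \<bullet> t)))
          * (g (t - fst l) * cnj (g (t - fst m)))"
      by (simp only: tfshift complex_cnj_mult mult_ac)
    also have "cis (2 * pi * (snd l \<bullet> t)) * cnj (cis (2 * pi * (snd m \<bullet> t)))
        = c * cnj (cis (2 * pi * (snd (m - l) \<bullet> (t - fst l))))"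
      by (simp add: c_def cis_cnj cis_mult algebra_simps)
    also have "t - fst m = t - fst l - fst (m - l)"
      by simp
    finally show ?thesis
      by (simp only: tfshift complex_cnj_mult mult_ac)
  qed
  then have "inner_L2 (tfshift l g) (tfshift m g) = c * (LINT t|lebesgue. ?F (t - fst l))"
    by (simp add: inner_L2_def)
  also have "(LINT t|lebesgue. ?F (t - fst l)) = stft g g (m - l)"
    unfolding stft_def inner_L2_def
    using assms by (intro integral_lebesgue_translation borel_measurable_integrable L2_integrable_mult tfshift_L2)
  finally show ?thesis
    by (simp add: norm_mult c)
qed

lemma stft_origin: "stft g g 0 = complex_of_real ((norm_L2 g)^2)"
proof -
  have "tfshift 0 g = g"
    by (simp add: tfshift_def)
  then show ?thesis
    by (simp add: stft_def inner_L2_same)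
qed

lemma norm_tfshift:
  assumes "g \<in> L2"
  shows "norm_L2 (tfshift l g) = norm_L2 g"
proof -
  have "cmod (complex_of_real ((norm_L2 (tfshift l g))^2)) = cmod (complex_of_real ((norm_L2 g)^2))"
    using norm_inner_tfshift[OF assms, of l l] by (simp only: diff_self stft_origin inner_L2_same)
  then have "(norm_L2 (tfshift l g))^2 = (norm_L2 g)^2"
    by (simp only: norm_of_real abs_power2 abs_of_nonneg zero_le_power2)
  moreover have "norm_L2 f \<ge> 0" for f :: "real^'a::finite \<Rightarrow> complex"
    by (simp add: norm_L2_def)
  ultimately show ?thesis
    by (metis power2_eq_imp_eq)
qed

section \<open>Spectrum of the Gabor multiplier\<close>

text \<open>Pythagoras for the columns of the matrix \<open>a\<close>, pairwise orthogonal with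
  squared norms \<open>ev k\<close>. It is applied with
  \<open>a l k = stft g (h k) l\<close>.\<close>

lemma sum_orthogonal_combination:
  fixes a :: "'i \<Rightarrow> 'k \<Rightarrow> complex" and ev :: "'k \<Rightarrow> real"
  assumes "finite K"
    and orth: "\<And>j k. (\<Sum>l\<in>I. a l j * cnj (a l k)) = (if j = k then complex_of_real (ev k) else 0)"
  shows "(\<Sum>l\<in>I. (cmod (\<Sum>k\<in>K. c k * a l k))^2) = (\<Sum>k\<in>K. (cmod (c k))^2 * ev k)"
proof -
  have "complex_of_real (\<Sum>l\<in>I. (cmod (\<Sum>k\<in>K. c k * a l k))^2)
      = (\<Sum>l\<in>I. \<Sum>j\<in>K. \<Sum>k\<in>K. c j * cnj (c k) * (a l j * cnj (a l k)))"
    by (simp add: complex_norm_square sum_product mult_ac del: of_real_power)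
  also have "\<dots> = (\<Sum>j\<in>K. \<Sum>k\<in>K. c j * cnj (c k) * (\<Sum>l\<in>I. a l j * cnj (a l k)))"
    unfolding sum_distrib_left by (subst sum.swap, intro sum.cong refl sum.swap)
  also have "\<dots> = (\<Sum>j\<in>K. c j * cnj (c j) * complex_of_real (ev j))"
    unfolding orth using assms(1) by (intro sum.cong refl) (simp add: if_distrib cong: if_cong)
  also have "\<dots> = complex_of_real (\<Sum>k\<in>K. (cmod (c k))^2 * ev k)"
    by (simp add: complex_norm_square del: of_real_power)
  finally show ?thesis
    by (simp only: of_real_eq_iff)
qed

lemma orthogonal_norm_square:
  fixes a :: "'i \<Rightarrow> 'k \<Rightarrow> complex" and ev :: "'k \<Rightarrow> real"
  assumes orth: "\<And>j k. (\<Sum>l\<in>I. a l j * cnj (a l k)) = (if j = k then complex_of_real (ev k) else 0)"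
  shows "(\<Sum>l\<in>I. (cmod (a l k))^2) = ev k"
  using sum_orthogonal_combination[OF _ orth, of "{k}" "\<lambda>_. 1"] by simp

text \<open>The quantity \<open>s\<close> below is both the \<open>m\<close>-th coordinate and the squared norm of the projection
  of the \<open>m\<close>-th unit vector to the span of the columns, so \<open>s\<^sup>2 \<le> s\<close>.\<close>

lemma card_orthogonal_columns:
  fixes a :: "'i \<Rightarrow> 'k \<Rightarrow> complex" and ev :: "'k \<Rightarrow> real"
  assumes "finite I" "finite K" "\<And>k. k \<in> K \<Longrightarrow> ev k \<noteq> 0"
    and orth: "\<And>j k. (\<Sum>l\<in>I. a l j * cnj (a l k)) = (if j = k then complex_of_real (ev k) else 0)"
  shows "card K \<le> card I"
proof -
  note norm = orthogonal_norm_square[OF orth]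
  have pos: "ev k > 0" if "k \<in> K" for k
    using assms(3)[OF that] norm[of k] sum_nonneg[of I "\<lambda>l. (cmod (a l k))^2"] by simp
  have le1: "(\<Sum>k\<in>K. (cmod (a m k))^2 / ev k) \<le> 1" if "m \<in> I" for m
  proof -
    let ?s = "\<Sum>k\<in>K. (cmod (a m k))^2 / ev k"
    let ?c = "\<lambda>k. cnj (a m k) / complex_of_real (ev k)"
    have s0: "?s \<ge> 0"
      using pos by (intro sum_nonneg divide_nonneg_pos) auto
    have "(\<Sum>k\<in>K. ?c k * a m k) = complex_of_real ?s"
      by (simp add: complex_norm_square mult_ac del: of_real_power)
    then have "?s^2 = (cmod (\<Sum>k\<in>K. ?c k * a m k))^2"
      using s0 by (simp only: norm_of_real power2_abs)
    also have "\<dots> \<le> (\<Sum>l\<in>I. (cmod (\<Sum>k\<in>K. ?c k * a l k))^2)"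
      using that assms(1) by (intro member_le_sum) auto
    also have "\<dots> = (\<Sum>k\<in>K. (cmod (?c k))^2 * ev k)"
      using assms(2) orth by (rule sum_orthogonal_combination)
    also have "\<dots> = ?s"
      using pos by (intro sum.cong refl) (simp add: norm_divide power_divide power2_eq_square)
    finally show ?thesis
      using s0 mult_le_cancel_right[of ?s ?s 1] by (auto simp: power2_eq_square)
  qed
  \<comment> \<open>Exchanging the sums makes \<open>card K\<close> the trace of the projection onto
    the span of the columns, whose diagonal entries are at most 1.\<close>
  have "real (card K) = (\<Sum>k\<in>K. (\<Sum>m\<in>I. (cmod (a m k))^2) / ev k)"
    unfolding norm using assms(3) by simp
  also have "\<dots> = (\<Sum>m\<in>I. \<Sum>k\<in>K. (cmod (a m k))^2 / ev k)"
    unfolding sum_divide_distrib by (rule sum.swap)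
  also have "\<dots> \<le> (\<Sum>m\<in>I. 1)"
    using le1 by (intro sum_mono)
  finally show ?thesis
    by simp
qed

text \<open>\<open>\<Lambda>\<close> stands for any set whose shifts of \<open>g\<close> form a
  tight frame; the group law enters in \<open>spill_has_sum\<close>, the geometry in the counting
  section.\<close>

locale gabor_eigen =
  fixes g :: "real^'n::finite \<Rightarrow> complex" and \<Lambda> \<Omega> :: "'n phase set"
    and h :: "nat \<Rightarrow> real^'n \<Rightarrow> complex" and ev :: "nat \<Rightarrow> real"
  assumes g: "g \<in> L2" and norm_g: "norm_L2 g \<noteq> 0" and frame: "tight_frame1 g \<Lambda>"
    and finite_I: "finite (\<Lambda> \<inter> \<Omega>)"
    and eig: "eigendecomp (gabor_mult g \<Lambda> \<Omega>) h ev"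
begin

abbreviation I where "I \<equiv> \<Lambda> \<inter> \<Omega>"
abbreviation b where "b \<equiv> (norm_L2 g)^2"

section \<open>Eigenvalues of the multiplier through the transforms of its eigenfunctions\<close>

lemma h: "h k \<in> L2"
  and h_orth: "inner_L2 (h j) (h k) = (if j = k then 1 else 0)"
  and h_complete: "f \<in> L2 \<Longrightarrow> (\<And>k. inner_L2 f (h k) = 0) \<Longrightarrow> norm_L2 f = 0"
  and ev_antimono: "antimono ev"
  and ev_AE: "AE t in lebesgue. gabor_mult g \<Lambda> \<Omega> (h k) t = complex_of_real (ev k) * h k t"
  using eig by (auto simp: eigendecomp_def ONB_L2_def)

lemma norm_h: "norm_L2 (h k) = 1"
proof -
  have "complex_of_real ((norm_L2 (h k))^2) = 1"
    using h_orth[of k k] unfolding inner_L2_same by simp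
  then have "(norm_L2 (h k))^2 = 1"
    by (simp only: of_real_eq_1_iff)
  moreover have "norm_L2 (h k) \<ge> 0"
    by (simp add: norm_L2_def)
  ultimately show ?thesis
    by (simp add: power2_eq_1_iff)
qed

text \<open>Both sides are the inner product of \<open>gabor_mult g \<Lambda> \<Omega> (h j)\<close>
  with \<open>h k\<close>, computed once from the finite sum and once from the eigenvalue
  equation.\<close>

lemma coefficients_orthogonal:
  "(\<Sum>l\<in>I. stft g (h j) l * cnj (stft g (h k) l)) = (if j = k then complex_of_real (ev k) else 0)"
proof -
  have L2: "(\<lambda>t. stft g (h j) l * tfshift l g t) \<in> L2" for l
    by (intro L2_scale tfshift_L2 g)
  have "(\<Sum>l\<in>I. stft g (h j) l * cnj (stft g (h k) l))
      = (\<Sum>l\<in>I. inner_L2 (\<lambda>t. stft g (h j) l * tfshift l g t) (h k))"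
    by (simp add: inner_L2_scale_left stft_def cnj_inner_L2)
  also have "\<dots> = inner_L2 (gabor_mult g \<Lambda> \<Omega> (h j)) (h k)"
    unfolding gabor_mult_def by (rule inner_L2_sum_left[symmetric]) (use L2 h in auto)
  also have "\<dots> = inner_L2 (\<lambda>t. complex_of_real (ev j) * h j t) (h k)"
    by (intro inner_L2_cong_AE ev_AE L2_scale h)
       (unfold gabor_mult_def, intro L2_sum L2)
  also have "\<dots> = (if j = k then complex_of_real (ev k) else 0)"
    by (simp add: inner_L2_scale_left h_orth)
  finally show ?thesis .
qed

lemma ev_eq: "ev k = (\<Sum>l\<in>I. (cmod (stft g (h k) l))^2)"
  using orthogonal_norm_square[OF coefficients_orthogonal] by simp

lemma frame_h: "((\<lambda>l. (cmod (stft g (h k) l))^2) has_sum 1) \<Lambda>"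
  using frame h[of k] norm_h[of k] unfolding tight_frame1_def by fastforce

text \<open>By \<open>ev_eq\<close>, the eigenvalue is a partial sum of a frame series with total
  1.\<close>

lemma ev_le_1: "ev k \<le> 1"
  unfolding ev_eq using frame_h by (rule finite_sum_le_has_sum) (use finite_I in auto)

lemma ev_nonneg: "ev k \<ge> 0"
  unfolding ev_eq by (intro sum_nonneg) simp

text \<open>Nonzero eigenvalues yield nonzero, pairwise orthogonal columns of coefficients over
  \<open>I\<close>, and there are at most \<open>card I\<close> of those.\<close>

lemma finite_ev: "finite {k. ev k \<noteq> 0}"
proof (rule ccontr)
  assume "infinite {k. ev k \<noteq> 0}"
  then obtain K where "finite K" "card K = Suc (card I)" "K \<subseteq> {k. ev k \<noteq> 0}"
    by (meson infinite_arbitrarily_large)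
  then have "card K \<le> card I"
    using finite_I by (intro card_orthogonal_columns[OF _ _ _ coefficients_orthogonal]) auto
  with \<open>card K = Suc (card I)\<close> show False
    by simp
qed

section \<open>Residuals after orthogonal projection onto finitely many eigenfunctions\<close>

definition residual where
  "residual K f = (\<lambda>t. f t - (\<Sum>k\<in>K. inner_L2 f (h k) * h k t))"

lemma residual_L2:
  assumes "f \<in> L2"
  shows "residual K f \<in> L2"
  using L2_add[OF assms L2_scale[OF L2_sum[OF L2_scale[OF h]], of "-1"]]
  unfolding residual_def by simp

lemma inner_residual:
  assumes "f \<in> L2" "u \<in> L2"
  shows "inner_L2 (residual K f) u = inner_L2 f u - (\<Sum>k\<in>K. inner_L2 f (h k) * inner_L2 (h k) u)"
  using assms h unfolding residual_def
  by (simp add: inner_L2_diff_left inner_L2_sum_left inner_L2_scale_left L2_sum L2_scale)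

lemma inner_residual_basis:
  assumes "f \<in> L2" "finite K"
  shows "inner_L2 (residual K f) (h k) = (if k \<in> K then 0 else inner_L2 f (h k))"
  using assms by (simp add: inner_residual h h_orth if_distrib cong: if_cong)

text \<open>The right side minus the left is the squared norm of the residual. The argument order
  matches \<open>stft g (h k) l\<close>.\<close>

lemma bessel:
  assumes f: "f \<in> L2" and K: "finite K"
  shows "(\<Sum>k\<in>K. (cmod (inner_L2 (h k) f))^2) \<le> (norm_L2 f)^2"
proof -
  let ?r = "residual K f"
  have r: "?r \<in> L2"
    using f by (rule residual_L2)
  have cmod: "(complex_of_real (cmod (inner_L2 (h k) f)))^2 = inner_L2 f (h k) * inner_L2 (h k) f" for k
    using complex_norm_square[of "inner_L2 (h k) f"] by (simp add: cnj_inner_L2 mult.commute)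
  have "inner_L2 (h k) ?r = 0" if "k \<in> K" for k
  proof -
    have "inner_L2 ?r (h k) = 0"
      unfolding inner_residual_basis[OF f K] using that by simp
    then show ?thesis
      by (subst cnj_inner_L2[symmetric]) simp
  qed
  then have "inner_L2 ?r ?r = inner_L2 f ?r"
    by (simp add: inner_residual[OF f r])
  also have "\<dots> = cnj (inner_L2 ?r f)"
    by (simp add: cnj_inner_L2)
  also have "inner_L2 ?r f = complex_of_real ((norm_L2 f)^2 - (\<Sum>k\<in>K. (cmod (inner_L2 (h k) f))^2))"
    unfolding inner_residual[OF f f] inner_L2_same by (simp add: cmod)
  finally have "(norm_L2 ?r)^2 = (norm_L2 f)^2 - (\<Sum>k\<in>K. (cmod (inner_L2 (h k) f))^2)"
    unfolding inner_L2_same by (simp only: complex_cnj_complex_of_real of_real_eq_iff)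
  then show ?thesis
    using zero_le_power2[of "norm_L2 ?r"] by linarith
qed

text \<open>Completeness of the basis enters only here; as the sum is finite, no completeness of \<open>L2\<close> as a
  metric space is needed.\<close>

lemma gram_expansion:
  assumes K: "finite K" "{k. ev k \<noteq> 0} \<subseteq> K" and "l \<in> I"
  shows "inner_L2 (tfshift l g) (tfshift m g)
    = (\<Sum>k\<in>K. cnj (stft g (h k) l) * stft g (h k) m)"
proof -
  have p: "tfshift z g \<in> L2" for z
    by (rule tfshift_L2[OF g])
  let ?r = "residual K (tfshift l g)"
  \<comment> \<open>Outside \<open>K\<close> the eigenvalue is 0, and by \<open>ev_eq\<close> it is
    a sum of squares over \<open>I\<close>, which contains \<open>l\<close>.\<close>
  have "stft g (h j) l = 0" if "j \<notin> K" for j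
  proof -
    have "ev j = 0"
      using that K(2) by auto
    then have "(\<Sum>l\<in>I. (cmod (stft g (h j) l))^2) = 0"
      by (simp only: flip: ev_eq)
    then show ?thesis
      using assms(3) finite_I by (subst (asm) sum_nonneg_eq_0_iff) auto
  qed
  then have "inner_L2 ?r (h j) = 0" for j
    using cnj_inner_L2[of "h j" "tfshift l g"] K(1) p
    by (auto simp: inner_residual_basis stft_def)
  then have "norm_L2 ?r = 0"
    by (intro h_complete residual_L2 p)
  then have "inner_L2 ?r (tfshift m g) = 0"
    by (intro inner_L2_null_left residual_L2 p)
  then show ?thesis
    by (simp add: inner_residual p stft_def cnj_inner_L2)
qed

text \<open>The diagonal case \<open>m = l\<close> of \<open>gram_expansion\<close>, summed over
  \<open>I\<close>: each shift of \<open>g\<close> has squared norm \<open>b\<close>.\<close>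

lemma trace:
  assumes "finite K" "{k. ev k \<noteq> 0} \<subseteq> K"
  shows "(\<Sum>k\<in>K. ev k) = real (card I) * b"
proof -
  have "(\<Sum>k\<in>K. (cmod (stft g (h k) l))^2) = b" if "l \<in> I" for l
  proof -
    have "complex_of_real (\<Sum>k\<in>K. (cmod (stft g (h k) l))^2) = complex_of_real b"
      using gram_expansion[OF assms that, of l]
      by (simp add: inner_L2_same norm_tfshift g complex_norm_square mult_ac del: of_real_power)
    then show ?thesis
      by (simp only: of_real_eq_iff)
  qed
  then have "(\<Sum>l\<in>I. \<Sum>k\<in>K. (cmod (stft g (h k) l))^2) = real (card I) * b"
    by simp
  then show ?thesis
    by (subst (asm) sum.swap) (simp add: ev_eq)
qed

text \<open>The Gram matrix of the shifts over \<open>I\<close> and the multiplier share their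
  nonzero eigenvalues; the right side is the squared Hilbert-Schmidt norm of that matrix.\<close>

lemma trace_square:
  assumes "finite K" "{k. ev k \<noteq> 0} \<subseteq> K"
  shows "(\<Sum>k\<in>K. (ev k)^2) = (\<Sum>l\<in>I. \<Sum>m\<in>I. (cmod (inner_L2 (tfshift l g) (tfshift m g)))^2)"
proof -
  have "(\<Sum>l\<in>I. \<Sum>m\<in>I. (cmod (inner_L2 (tfshift l g) (tfshift m g)))^2)
      = (\<Sum>l\<in>I. \<Sum>m\<in>I. (cmod (\<Sum>k\<in>K. cnj (stft g (h k) l) * stft g (h k) m))^2)"
    by (intro sum.cong refl) (simp only: gram_expansion[OF assms])
  \<comment> \<open>For fixed \<open>l\<close>, the sum over \<open>m\<close> is Pythagoras with
    coefficients \<open>cnj (stft g (h k) l)\<close>.\<close>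
  also have "\<dots> = (\<Sum>l\<in>I. \<Sum>k\<in>K. (cmod (stft g (h k) l))^2 * ev k)"
    using sum_orthogonal_combination[OF assms(1) coefficients_orthogonal] by simp
  also have "\<dots> = (\<Sum>k\<in>K. (ev k)^2)"
    by (subst sum.swap) (simp add: power2_eq_square ev_eq flip: sum_distrib_right)
  finally show ?thesis
    by simp
qed

end

section \<open>The accumulated spectrogram\<close>

lemma has_sum_finite_sum:
  fixes f :: "'i \<Rightarrow> 'a \<Rightarrow> real"
  assumes "\<And>i. i \<in> J \<Longrightarrow> (f i has_sum s i) A"
  shows "((\<lambda>x. \<Sum>i\<in>J. f i x) has_sum (\<Sum>i\<in>J. s i)) A"
  using assms by (induction J rule: infinite_finite_induct) (auto intro: has_sum_add)

context gabor_eigen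
begin

abbreviation A where "A \<equiv> A_Omega g \<Lambda> \<Omega>"
abbreviation \<rho> where "\<rho> \<equiv> acc_spec g \<Lambda> \<Omega> h"

lemma A_bounds: "real (card I) * b \<le> real A" "real A < real (card I) * b + 1"
proof -
  have *: "0 \<le> real (card I) * b"
    by simp
  show "real (card I) * b \<le> real A" "real A < real (card I) * b + 1"
    unfolding A_Omega_def Int_commute[of \<Omega>] using * by linarith+
qed

lemma \<rho>_nonneg: "\<rho> l \<ge> 0"
  by (simp add: acc_spec_def sum_nonneg)

text \<open>Bessel's inequality for \<open>tfshift l g\<close>, whose squared norm \<open>b\<close>
  is the normalising factor of \<open>\<rho>\<close>.\<close>

lemma \<rho>_le_1: "\<rho> l \<le> 1"
proof -
  have "(\<Sum>k<A. (cmod (stft g (h k) l))^2) \<le> (norm_L2 (tfshift l g))^2"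
    unfolding stft_def by (intro bessel tfshift_L2 g) simp
  then show ?thesis
    using norm_g by (simp add: acc_spec_def norm_tfshift[OF g] divide_le_eq_1)
qed

lemma \<rho>_has_sum: "(\<rho> has_sum (real A / b)) \<Lambda>"
  using has_sum_cmult_right[OF has_sum_finite_sum[where J = "{..<A}", OF frame_h], of "1 / b"]
  unfolding acc_spec_def by simp

lemma sum_\<rho>: "b * (\<Sum>l\<in>I. \<rho> l) = (\<Sum>k<A. ev k)"
proof -
  have "b * (\<Sum>l\<in>I. \<rho> l) = (\<Sum>l\<in>I. \<Sum>k<A. (cmod (stft g (h k) l))^2)"
    using norm_g by (simp add: acc_spec_def sum_distrib_left)
  then show ?thesis
    by (subst (asm) sum.swap) (simp add: ev_eq)
qed

abbreviation err where "err \<equiv> l1_norm \<Lambda> (\<lambda>l. \<rho> l - indicator \<Omega> l)"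

lemma err_eq: "b * err = real (card I) * b + real A - 2 * (\<Sum>k<A. ev k)"
proof -
  \<comment> \<open>As \<open>\<rho>\<close> lies between 0 and 1, the sign is known on and off
    \<open>\<Omega>\<close>; what remains is the summable \<open>\<rho>\<close> plus a correction
    supported on the finite set \<open>I\<close>.\<close>
  have abs: "\<bar>\<rho> l - indicator \<Omega> l\<bar> = \<rho> l + of_bool (l \<in> \<Omega>) * (1 - 2 * \<rho> l)" for l
    using \<rho>_nonneg[of l] \<rho>_le_1[of l] by (simp add: indicator_def)
  have "((\<lambda>l. of_bool (l \<in> \<Omega>) * (1 - 2 * \<rho> l)) has_sum (\<Sum>l\<in>I. 1 - 2 * \<rho> l)) \<Lambda>"
    by (rule has_sum_finite_neutralI[OF finite_I]) auto
  from has_sum_add[OF \<rho>_has_sum this]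
  have "((\<lambda>l. \<bar>\<rho> l - indicator \<Omega> l\<bar>) has_sum (real A / b + (\<Sum>l\<in>I. 1 - 2 * \<rho> l))) \<Lambda>"
    unfolding abs by simp
  then have "err = real A / b + (real (card I) - 2 * (\<Sum>l\<in>I. \<rho> l))"
    unfolding l1_norm_def by (subst infsumI) (auto simp: sum_subtractf sum_distrib_left)
  then have "b * err = b * (real A / b) + (real (card I) * b - 2 * (b * (\<Sum>l\<in>I. \<rho> l)))"
    by (simp only: distrib_left right_diff_distrib mult_ac)
  then show ?thesis
    unfolding sum_\<rho> using norm_g by simp
qed

text \<open>The \<open>P\<close> of the opening outline in lattice form: by the frame identity, each
  summand is the energy that the transform of \<open>tfshift l g\<close> has outside
  \<open>\<Omega>\<close>.\<close>

definition spill where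
  "spill = (\<Sum>l\<in>I. b - (\<Sum>m\<in>I. (cmod (stft g g (m - l)))^2))"

lemma spill_eq:
  assumes "finite K" "{k. ev k \<noteq> 0} \<subseteq> K"
  shows "spill = (\<Sum>k\<in>K. ev k * (1 - ev k))"
proof -
  have "(\<Sum>k\<in>K. ev k * (1 - ev k)) = (\<Sum>k\<in>K. ev k) - (\<Sum>k\<in>K. (ev k)^2)"
    by (simp add: right_diff_distrib power2_eq_square sum_subtractf)
  then show ?thesis
    unfolding trace[OF assms] trace_square[OF assms] spill_def
    by (simp add: norm_inner_tfshift[OF g] sum_subtractf)
qed

lemma err_bounds: "spill \<le> b * err" "b * err \<le> 4 * spill + 1"
proof -
  \<comment> \<open>The bound \<open>n\<close> obtained here is at least \<open>A\<close> and lies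
    beyond every nonzero eigenvalue, so sums below \<open>n\<close> are the full series.\<close>
  obtain n0 where "{k. ev k \<noteq> 0} \<subseteq> {..<n0}"
    using finite_ev finite_nat_iff_bounded by blast
  then obtain n where n: "A \<le> n" "{k. ev k \<noteq> 0} \<subseteq> {..<n}"
    by (meson lessThan_subset_iff max.cobounded1 max.cobounded2 subset_trans)
  have split: "(\<Sum>k<n. f k) = (\<Sum>k<A. f k) + (\<Sum>k=A..<n. f k)" for f :: "nat \<Rightarrow> real"
    using n(1) by (simp add: lessThan_atLeast0 sum.atLeastLessThan_concat)
  define X Y P Q where "X = (\<Sum>k<A. 1 - ev k)" and "Y = (\<Sum>k=A..<n. ev k)"
    and "P = (\<Sum>k<A. ev k * (1 - ev k))" and "Q = (\<Sum>k=A..<n. ev k * (1 - ev k))"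
  have spill: "spill = P + Q"
    using spill_eq[OF _ n(2)] unfolding split P_def Q_def by simp
  have X: "X = real A - (\<Sum>k<A. ev k)"
    by (simp add: X_def sum_subtractf)
  have tr: "real (card I) * b = (\<Sum>k<A. ev k) + Y"
    using trace[OF _ n(2)] unfolding split Y_def by simp
  have err: "b * err = X + Y"
    unfolding err_eq X using tr by simp
  \<comment> \<open>\<open>X - Y\<close> is \<open>real A - real (card I) * b\<close>, which the
    ceiling in \<open>A_Omega\<close> keeps between 0 and 1.\<close>
  have XY: "Y \<le> X" "X \<le> Y + 1"
    using A_bounds X tr by linarith+
  have "P \<le> X"
    unfolding P_def X_def by (intro sum_mono mult_left_le_one_le) (simp_all add: ev_nonneg ev_le_1)
  moreover have "Q \<le> Y"
    unfolding Q_def Y_def by (intro sum_mono mult_left_le) (simp_all add: ev_nonneg ev_le_1)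
  ultimately show "spill \<le> b * err"
    using spill err by simp
  have nonneg: "P \<ge> 0" "Q \<ge> 0"
    unfolding P_def Q_def using ev_nonneg ev_le_1 by (auto intro!: sum_nonneg)
  show "b * err \<le> 4 * spill + 1"
  \<comment> \<open>If \<open>ev A \<le> 1/2\<close>, so are all later eigenvalues, giving
    \<open>Y \<le> 2 * Q\<close> and \<open>X + Y \<le> 2 * Y + 1\<close>. Otherwise all earlier
    ones exceed 1/2, giving \<open>X \<le> 2 * P\<close> and
    \<open>X + Y \<le> 2 * X\<close>.\<close>
  proof (cases "ev A \<le> 1/2")
    case True
    have "Y \<le> 2 * Q"
      unfolding Y_def Q_def sum_distrib_left
    proof (rule sum_mono)
      fix k assume "k \<in> {A..<n}"
      then have "ev k \<le> 1/2"
        using True antimonoD[OF ev_antimono, of A k] by simp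
      then show "ev k \<le> 2 * (ev k * (1 - ev k))"
        using mult_left_mono[of "1/2" "1 - ev k" "ev k"] ev_nonneg[of k] by simp
    qed
    then show ?thesis
      using spill err XY nonneg by linarith
  next
    case False
    have "X \<le> 2 * P"
      unfolding X_def P_def sum_distrib_left
    proof (rule sum_mono)
      fix k assume "k \<in> {..<A}"
      then have "1/2 \<le> ev k"
        using False antimonoD[OF ev_antimono, of k A] by simp
      then show "1 - ev k \<le> 2 * (ev k * (1 - ev k))"
        using mult_right_mono[of "1/2" "ev k" "1 - ev k"] ev_le_1[of k] by simp
    qed
    then show ?thesis
      using spill err XY nonneg by linarith
  qed
qed

text \<open>The frame identity turns each summand of \<open>spill\<close> into a series over the
  \<open>m\<close> outside \<open>\<Omega>\<close>. Substituting \<open>m = l + v\<close>, a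
  permutation of the group \<open>\<Lambda>\<close>, makes the weight independent of
  \<open>l\<close>, and the finite sum over \<open>l\<close> becomes a count.\<close>

lemma spill_has_sum:
  assumes add: "\<And>l m. l \<in> \<Lambda> \<Longrightarrow> m \<in> \<Lambda> \<Longrightarrow> l + m \<in> \<Lambda>"
    and diff: "\<And>l m. l \<in> \<Lambda> \<Longrightarrow> m \<in> \<Lambda> \<Longrightarrow> l - m \<in> \<Lambda>"
  shows "((\<lambda>v. (cmod (stft g g v))^2 * real (card {l\<in>I. l + v \<notin> \<Omega>})) has_sum spill) \<Lambda>"
proof -
  let ?F = "\<lambda>v. (cmod (stft g g v))^2"
  have "((\<lambda>v. ?F v * of_bool (l + v \<notin> \<Omega>)) has_sum (b - (\<Sum>m\<in>I. ?F (m - l)))) \<Lambda>"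
    if l: "l \<in> I" for l
  proof -
    have of_bool: "?F (m - l) + - (?F (m - l) * of_bool (m \<in> \<Omega>)) = ?F (m - l) * of_bool (m \<notin> \<Omega>)" for m
      by simp
    have "((\<lambda>m. (cmod (stft g (tfshift l g) m))^2) has_sum b) \<Lambda>"
      using frame tfshift_L2[OF g, of l] norm_tfshift[OF g, of l]
      unfolding tight_frame1_def by fastforce
    then have "((\<lambda>m. ?F (m - l)) has_sum b) \<Lambda>"
      by (simp add: stft_def[of g "tfshift l g"] norm_inner_tfshift[OF g])
    moreover have "((\<lambda>m. - (?F (m - l) * of_bool (m \<in> \<Omega>))) has_sum - (\<Sum>m\<in>I. ?F (m - l))) \<Lambda>"
      by (rule has_sum_finite_neutralI[OF finite_I]) (auto simp: sum_negf)
    ultimately have "((\<lambda>m. ?F (m - l) + - (?F (m - l) * of_bool (m \<in> \<Omega>)))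
        has_sum (b + - (\<Sum>m\<in>I. ?F (m - l)))) \<Lambda>"
      by (rule has_sum_add)
    then have "((\<lambda>m. ?F (m - l) * of_bool (m \<notin> \<Omega>)) has_sum (b - (\<Sum>m\<in>I. ?F (m - l)))) \<Lambda>"
      by (simp only: of_bool) simp
    moreover have "bij_betw (\<lambda>v. l + v) \<Lambda> \<Lambda>"
      using l add diff by (intro bij_betwI[where g = "\<lambda>m. m - l"]) auto
    ultimately show ?thesis
      by (subst (asm) has_sum_reindex_bij_betw[symmetric]) (auto simp: algebra_simps)
  qed
  from has_sum_finite_sum[OF this, of I]
  have "((\<lambda>v. \<Sum>l\<in>I. ?F v * of_bool (l + v \<notin> \<Omega>)) has_sum spill) \<Lambda>"
    unfolding spill_def by simp
  moreover have "(\<Sum>l\<in>I. ?F v * of_bool (l + v \<notin> \<Omega>)) = ?F v * real (card {l\<in>I. l + v \<notin> \<Omega>})" for v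
  proof -
    have "I \<inter> {l. l + v \<notin> \<Omega>} = {l\<in>I. l + v \<notin> \<Omega>}"
      by blast
    then show ?thesis
      using finite_I by (simp only: flip: sum_distrib_left) (simp only: sum_of_bool_eq)
  qed
  ultimately show ?thesis
    by simp
qed

end

section \<open>Counting lattice points near the boundary\<close>

lemma finite_vec_coordinates:
  assumes "finite F"
  shows "finite {x :: 'a^'n::finite. \<forall>i. x $ i \<in> F}"
proof -
  have "{x :: 'a^'n. \<forall>i. x $ i \<in> F} \<subseteq> vec_lambda ` (PiE UNIV (\<lambda>_. F))"
    by (auto intro!: image_eqI[where x = "vec_nth _"])
  moreover have "finite (PiE (UNIV :: 'n set) (\<lambda>_. F))"
    using assms by (intro finite_PiE) auto
  ultimately show ?thesis
    by (blast intro: finite_subset)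
qed

lemma finite_int_points_bounded:
  assumes "bounded S"
  shows "finite (int_points \<inter> S :: 'n::finite phase set)"
proof -
  obtain B where B: "\<And>z. z \<in> S \<Longrightarrow> norm z \<le> B"
    using assms by (auto simp: bounded_iff)
  let ?F = "{x::real. x \<in> \<int> \<and> \<bar>x\<bar> \<le> B}"
  have "\<bar>fst z $ i\<bar> \<le> B" "\<bar>snd z $ i\<bar> \<le> B" if "z \<in> S" for z i
    using B[OF that] component_le_norm_cart[of "fst z" i] component_le_norm_cart[of "snd z" i]
      norm_fst_le[of "fst z" "snd z"] norm_snd_le[of "snd z" "fst z"] by simp_all
  then have "int_points \<inter> S \<subseteq> {x. \<forall>i. x $ i \<in> ?F} \<times> {x. \<forall>i. x $ i \<in> ?F}"
    by (auto simp: int_points_def)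
  moreover have "finite ?F"
    by (rule finite_abs_int_segment)
  ultimately show ?thesis
    by (blast intro: finite_subset finite_cartesian_product finite_vec_coordinates)
qed

locale phase_lattice =
  fixes M :: "'n::finite phase \<Rightarrow> 'n phase"
  assumes linear: "linear M" and bij: "bij M"
begin

abbreviation \<Lambda> where "\<Lambda> \<equiv> lattice M"

lemma lattice_0: "0 \<in> \<Lambda>"
  unfolding lattice_def by (rule image_eqI[of _ _ 0]) (auto simp: linear_0[OF linear] int_points_def)

lemma lattice_add: "l \<in> \<Lambda> \<Longrightarrow> m \<in> \<Lambda> \<Longrightarrow> l + m \<in> \<Lambda>"
  unfolding lattice_def by (fastforce simp: int_points_def simp flip: linear_add[OF linear])

lemma lattice_diff: "l \<in> \<Lambda> \<Longrightarrow> m \<in> \<Lambda> \<Longrightarrow> l - m \<in> \<Lambda>"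
  unfolding lattice_def by (fastforce simp: int_points_def simp flip: linear_diff[OF linear])

text \<open>Pulling back along the linear map \<open>inv M\<close> keeps the set bounded and turns
  lattice points into integer points.\<close>

lemma finite_lattice_bounded:
  assumes "bounded S"
  shows "finite (\<Lambda> \<inter> S)"
proof -
  have "linear (inv M)"
    using linear bij by (metis bij_def inj_linear_imp_inv_linear)
  then have "bounded (inv M ` S)"
    using assms by (simp add: bounded_linear_image linear_linear)
  then have "finite (M ` (int_points \<inter> inv M ` S))"
    by (intro finite_imageI finite_int_points_bounded)
  moreover have "\<Lambda> \<inter> S \<subseteq> M ` (int_points \<inter> inv M ` S)"
  proof
    fix x assume "x \<in> \<Lambda> \<inter> S"
    then obtain z where "z \<in> int_points" "x = M z" "M z \<in> S"
      by (auto simp: lattice_def)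
    moreover from this have "z \<in> inv M ` S"
      using bij by (metis bij_inv_eq_iff image_eqI)
    ultimately show "x \<in> M ` (int_points \<inter> inv M ` S)"
      by blast
  qed
  ultimately show ?thesis
    by (rule finite_subset[rotated])
qed

lemma bounded_fund_domain: "bounded (fund_domain M)"
proof -
  have "{z :: 'n phase. \<forall>i. fst z $ i \<in> {0..<1} \<and> snd z $ i \<in> {0..<1}} \<subseteq> cbox 0 1 \<times> cbox 0 1"
    by (auto simp: mem_box_cart less_imp_le)
  then have "bounded {z :: 'n phase. \<forall>i. fst z $ i \<in> {0..<1} \<and> snd z $ i \<in> {0..<1}}"
    by (rule bounded_subset[rotated]) (intro bounded_Times bounded_cbox)
  then show ?thesis
    unfolding fund_domain_def using linear by (intro bounded_linear_image) (auto simp: linear_linear)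
qed

lemma lM_nonneg: "lM M \<ge> 0"
  unfolding lM_def by (intro diameter_ge_0 bounded_fund_domain)

text \<open>Rounding down the coordinates of \<open>inv M p\<close> leaves a remainder whose image
  lies, like 0, in the fundamental domain; hence its diameter is the bound.\<close>

lemma lattice_point_near:
  obtains l where "l \<in> \<Lambda>" "norm (p - l) \<le> lM M"
proof -
  define z where "z = inv M p"
  define k :: "'n phase" where
    "k = (\<chi> i. of_int \<lfloor>fst z $ i\<rfloor>, \<chi> i. of_int \<lfloor>snd z $ i\<rfloor>)"
  have p: "M z = p"
    using bij by (simp add: z_def bij_is_surj surj_f_inv_f)
  have "k \<in> int_points"
    by (simp add: k_def int_points_def)
  then have "M k \<in> \<Lambda>"
    by (simp add: lattice_def)
  moreover have "norm (p - M k) \<le> lM M"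
  proof -
    have "M (z - k) \<in> fund_domain M"
      unfolding fund_domain_def k_def
      by (intro imageI) (auto, linarith+)
    moreover have "M 0 \<in> fund_domain M"
      unfolding fund_domain_def by (intro imageI) simp
    ultimately have "dist (M (z - k)) (M 0) \<le> lM M"
      unfolding lM_def by (intro diameter_bounded_bound bounded_fund_domain)
    then show ?thesis
      by (simp add: linear_0[OF linear] linear_diff[OF linear] p)
  qed
  ultimately show thesis
    by (rule that)
qed

text \<open>Makes the count uniform in the centre: subtracting one lattice point of the ball moves
  all others into a ball of twice the radius about 0.\<close>

lemma card_lattice_cball_le:
  assumes "\<epsilon> \<ge> 0"
  shows "card (\<Lambda> \<inter> cball c \<epsilon>) \<le> card (\<Lambda> \<inter> cball 0 (2 * \<epsilon>))"
proof (cases "\<Lambda> \<inter> cball c \<epsilon> = {}")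
  case False
  then obtain l where l: "l \<in> \<Lambda>" "dist c l \<le> \<epsilon>"
    by auto
  have "(\<lambda>m. m - l) ` (\<Lambda> \<inter> cball c \<epsilon>) \<subseteq> \<Lambda> \<inter> cball 0 (2 * \<epsilon>)"
  proof (rule image_subsetI)
    fix m assume "m \<in> \<Lambda> \<inter> cball c \<epsilon>"
    moreover from this have "norm (m - l) \<le> 2 * \<epsilon>"
      using dist_triangle3[of m l c] l(2) by (simp flip: dist_norm)
    ultimately show "m - l \<in> \<Lambda> \<inter> cball 0 (2 * \<epsilon>)"
      using l lattice_diff by simp
  qed
  then have "card ((\<lambda>m. m - l) ` (\<Lambda> \<inter> cball c \<epsilon>)) \<le> card (\<Lambda> \<inter> cball 0 (2 * \<epsilon>))"
    by (intro card_mono finite_lattice_bounded) auto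
  then show ?thesis
    by (simp add: card_image)
qed simp

text \<open>The segment from 0 to \<open>-v\<close> is divided by \<open>n + 1\<close> points with
  gaps at most 1; balls of radius \<open>\<epsilon> + 1\<close> about them cover its
  neighbourhood.\<close>

lemma card_lattice_near_segment:
  assumes "\<epsilon> \<ge> 0"
  shows "real (card {w\<in>\<Lambda>. \<exists>t\<in>{0..1}. norm (w + t *\<^sub>R v) \<le> \<epsilon>})
    \<le> real (card (\<Lambda> \<inter> cball 0 (2 * (\<epsilon> + 1)))) * (norm v + 3)"
proof -
  \<comment> \<open>The added 1 keeps \<open>n\<close> positive when \<open>v = 0\<close>.\<close>
  define n where "n = nat \<lceil>norm v\<rceil> + 1"
  have n: "n > 0" "norm v \<le> real n" "real n \<le> norm v + 2"
    unfolding n_def using norm_ge_zero[of v] by linarith+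
  let ?B = "\<lambda>j::nat. \<Lambda> \<inter> cball (- ((real j / real n) *\<^sub>R v)) (\<epsilon> + 1)"
  have "{w\<in>\<Lambda>. \<exists>t\<in>{0..1}. norm (w + t *\<^sub>R v) \<le> \<epsilon>} \<subseteq> (\<Union>j\<in>{..n}. ?B j)"
  proof
    fix w assume "w \<in> {w\<in>\<Lambda>. \<exists>t\<in>{0..1}. norm (w + t *\<^sub>R v) \<le> \<epsilon>}"
    then obtain t where w: "w \<in> \<Lambda>" "norm (w + t *\<^sub>R v) \<le> \<epsilon>" and t: "t \<in> {0..1}"
      by blast
    define j where "j = nat \<lfloor>t * real n\<rfloor>"
    have tn: "0 \<le> t * real n" "t * real n \<le> real n"
      using t by (auto simp: mult_left_le_one_le)
    have j: "real j \<le> t * real n" "t * real n \<le> real j + 1"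
      unfolding j_def using tn by linarith+
    have "j \<le> n"
      using j(1) tn(2) by linarith
    have "real j / real n - t = (real j - t * real n) / real n"
      using n(1) by (simp add: field_simps)
    then have "\<bar>real j / real n - t\<bar> = \<bar>real j - t * real n\<bar> / real n"
      by simp
    also have "\<dots> \<le> 1 / real n"
      using j by (intro divide_right_mono) auto
    finally have "\<bar>real j / real n - t\<bar> * norm v \<le> 1 / real n * real n"
      using n by (intro mult_mono) auto
    then have "norm ((real j / real n - t) *\<^sub>R v) \<le> 1"
      using n(1) by simp
    then have "norm (w + (real j / real n) *\<^sub>R v) \<le> \<epsilon> + 1"
      using norm_triangle_ineq[of "w + t *\<^sub>R v" "(real j / real n - t) *\<^sub>R v"] w(2)
      by (simp add: algebra_simps)
    then have "dist (- ((real j / real n) *\<^sub>R v)) w \<le> \<epsilon> + 1"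
      by (simp add: dist_norm norm_minus_commute[of "- _"] )
    then show "w \<in> (\<Union>j\<in>{..n}. ?B j)"
      using w(1) \<open>j \<le> n\<close> by auto
  qed
  then have "card {w\<in>\<Lambda>. \<exists>t\<in>{0..1}. norm (w + t *\<^sub>R v) \<le> \<epsilon>} \<le> card (\<Union>j\<in>{..n}. ?B j)"
    by (intro card_mono finite_UN_I finite_lattice_bounded) auto
  also have "\<dots> \<le> (\<Sum>j\<in>{..n}. card (?B j))"
    by (rule card_UN_le) simp
  also have "\<dots> \<le> (\<Sum>j\<in>{..n}. card (\<Lambda> \<inter> cball 0 (2 * (\<epsilon> + 1))))"
    using assms by (intro sum_mono card_lattice_cball_le) simp
  also have "\<dots> = (n + 1) * card (\<Lambda> \<inter> cball 0 (2 * (\<epsilon> + 1)))"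
    by simp
  finally have "real (card {w\<in>\<Lambda>. \<exists>t\<in>{0..1}. norm (w + t *\<^sub>R v) \<le> \<epsilon>})
      \<le> real ((n + 1) * card (\<Lambda> \<inter> cball 0 (2 * (\<epsilon> + 1))))"
    by (rule of_nat_mono)
  also have "\<dots> \<le> (norm v + 3) * real (card (\<Lambda> \<inter> cball 0 (2 * (\<epsilon> + 1))))"
    unfolding of_nat_mult using n(3) by (intro mult_right_mono) auto
  finally show ?thesis
    by (simp add: mult.commute)
qed

section \<open>The discrete boundary and the points that a shift moves out\<close>

lemma disc_boundary_memI:
  assumes "l \<in> \<Lambda>" "a \<in> frontier \<Omega>" "norm (a - l) < \<epsilon>"
  shows "l \<in> disc_boundary \<Lambda> \<epsilon> \<Omega>"
proof -
  have "l = a + (l - a)" "l - a \<in> ball 0 \<epsilon>"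
    using assms(3) by (auto simp: norm_minus_commute)
  then show ?thesis
    unfolding disc_boundary_def using assms(1,2) by blast
qed

lemma finite_disc_boundary:
  assumes "bounded \<Omega>"
  shows "finite (disc_boundary \<Lambda> \<epsilon> \<Omega>)"
proof -
  have "bounded (frontier \<Omega>)"
    using bounded_closure[OF assms] by (rule bounded_subset) (simp add: frontier_def)
  from bounded_sums[OF this bounded_ball[of 0 \<epsilon>]] have "bounded {a + b | a b. a \<in> frontier \<Omega> \<and> b \<in> ball 0 \<epsilon>}"
    by (rule bounded_subset) blast
  then show ?thesis
    unfolding disc_boundary_def by (rule finite_lattice_bounded)
qed

text \<open>The segment from \<open>l\<close> to \<open>l + v\<close> crosses the frontier, so \<open>l\<close> lies close to a translate of the
  segment \<open>[-v, 0]\<close> by some point of the discrete boundary.\<close>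

lemma card_leaving_le:
  assumes "bounded \<Omega>" "r > 0"
  shows "real (card {l\<in>\<Lambda> \<inter> \<Omega>. l + v \<notin> \<Omega>})
    \<le> real (card (\<Lambda> \<inter> cball 0 (2 * (lM M + 1)))) * (norm v + 3)
      * real (card (disc_boundary \<Lambda> (r + lM M) \<Omega>))"
proof -
  let ?D = "disc_boundary \<Lambda> (r + lM M) \<Omega>"
  let ?S = "{w\<in>\<Lambda>. \<exists>t\<in>{0..1}. norm (w + t *\<^sub>R v) \<le> lM M}"
  have S: "finite ?S"
  proof -
    have "?S \<subseteq> \<Lambda> \<inter> cball 0 (lM M + norm v)"
    proof
      fix w assume "w \<in> ?S"
      then obtain t where w: "w \<in> \<Lambda>" "norm (w + t *\<^sub>R v) \<le> lM M" and t: "t \<in> {0..1}"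
        by blast
      have "norm w \<le> norm (w + t *\<^sub>R v) + norm (t *\<^sub>R v)"
        using norm_triangle_ineq4[of "w + t *\<^sub>R v" "t *\<^sub>R v"] by simp
      also have "norm (t *\<^sub>R v) \<le> norm v"
        using t by (simp add: mult_left_le_one_le)
      finally show "w \<in> \<Lambda> \<inter> cball 0 (lM M + norm v)"
        using w by simp
    qed
    then show ?thesis
      by (rule finite_subset) (intro finite_lattice_bounded bounded_cball)
  qed
  have "{l\<in>\<Lambda> \<inter> \<Omega>. l + v \<notin> \<Omega>} \<subseteq> (\<lambda>(m, w). m + w) ` (?D \<times> ?S)"
  proof
    fix l assume "l \<in> {l\<in>\<Lambda> \<inter> \<Omega>. l + v \<notin> \<Omega>}"
    then have l: "l \<in> \<Lambda>" "l \<in> \<Omega>" "l + v \<notin> \<Omega>"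
      by auto
    have "closed_segment l (l + v) \<inter> frontier \<Omega> \<noteq> {}"
      using l by (intro connected_Int_frontier connected_segment) auto
    then obtain a where "a \<in> closed_segment l (l + v)" "a \<in> frontier \<Omega>"
      by blast
    moreover from this obtain t where t: "t \<in> {0..1}" "a = (1 - t) *\<^sub>R l + t *\<^sub>R (l + v)"
      unfolding closed_segment_def by auto
    moreover have "(1 - t) *\<^sub>R l + t *\<^sub>R (l + v) = l + t *\<^sub>R v"
      by (simp add: scaleR_add_right scaleR_diff_left)
    ultimately have a: "l + t *\<^sub>R v \<in> frontier \<Omega>"
      by simp
    obtain m where m: "m \<in> \<Lambda>" "norm (l + t *\<^sub>R v - m) \<le> lM M"
      by (rule lattice_point_near)
    have "m \<in> ?D"
      using m a assms(2) by (intro disc_boundary_memI[of _ "l + t *\<^sub>R v"]) auto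
    moreover have "l - m \<in> ?S"
      using m l t lattice_diff by (auto simp: algebra_simps intro!: bexI[of _ t])
    ultimately show "l \<in> (\<lambda>(m, w). m + w) ` (?D \<times> ?S)"
      by (intro image_eqI[where x = "(m, l - m)"]) auto
  qed
  then have "card {l\<in>\<Lambda> \<inter> \<Omega>. l + v \<notin> \<Omega>} \<le> card (?D \<times> ?S)"
    using S finite_disc_boundary[OF assms(1)] by (intro surj_card_le) auto
  then have "real (card {l\<in>\<Lambda> \<inter> \<Omega>. l + v \<notin> \<Omega>}) \<le> real (card ?D) * real (card ?S)"
    by (simp only: card_cartesian_product of_nat_mono flip: of_nat_mult)
  also have "\<dots> \<le> real (card ?D) * (real (card (\<Lambda> \<inter> cball 0 (2 * (lM M + 1)))) * (norm v + 3))"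
    by (intro mult_left_mono card_lattice_near_segment lM_nonneg) simp
  finally show ?thesis
    by (simp add: mult_ac)
qed

text \<open>Serves to absorb the additive 1 of \<open>err_bounds\<close> into a multiple of the
  boundary count, for small \<open>R\<close> as well.\<close>

lemma disc_boundary_ball_nonempty:
  assumes "R > 0" "r > 0"
  shows "card (disc_boundary \<Lambda> (r + lM M) (ball 0 R)) \<ge> 1"
proof -
  obtain a :: "'n phase" where a: "norm a = R"
    using assms(1) vector_choose_size less_imp_le by metis
  obtain m where "m \<in> \<Lambda>" "norm (a - m) \<le> lM M"
    by (rule lattice_point_near)
  then have "m \<in> disc_boundary \<Lambda> (r + lM M) (ball 0 R)"
    using a assms by (intro disc_boundary_memI[of _ a]) auto
  moreover have "finite (disc_boundary \<Lambda> (r + lM M) (ball 0 R))"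
    by (intro finite_disc_boundary bounded_ball)
  ultimately show ?thesis
    by (metis One_nat_def Suc_leI card_gt_0_iff empty_iff)
qed

section \<open>Lattice points on either side of a sphere\<close>

lemma disc_boundary_ballE:
  assumes "l \<in> disc_boundary \<Lambda> \<epsilon> (ball 0 R)" "R > 0"
  obtains a where "l \<in> \<Lambda>" "norm a = R" "norm (l - a) < \<epsilon>"
  using assms by (auto simp: disc_boundary_def)

text \<open>A ball of radius \<open>lM M\<close> tangent to the sphere from the outside contains a lattice point.\<close>

lemma exists_lattice_outside_ball:
  assumes "l \<in> disc_boundary \<Lambda> (r + lM M) (ball 0 R)" "R > 0"
  obtains m where "m \<in> \<Lambda>" "m \<notin> ball 0 R" "norm (m - l) < r + 3 * lM M"
proof -
  obtain a where a: "norm a = R" "norm (l - a) < r + lM M"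
    using assms by (rule disc_boundary_ballE)
  define p where "p = (1 + lM M / R) *\<^sub>R a"
  have np: "norm p = R + lM M"
    using a(1) assms(2) lM_nonneg by (simp add: p_def field_simps)
  have pa: "norm (p - a) = lM M"
    using a(1) assms(2) lM_nonneg by (simp add: p_def algebra_simps)
  obtain m where m: "m \<in> \<Lambda>" "norm (p - m) \<le> lM M"
    by (rule lattice_point_near)
  have "m \<notin> ball 0 R"
    using np m(2) norm_triangle_ineq2[of p m] by simp
  \<comment> \<open>One \<open>lM M\<close> each comes from \<open>m\<close> to \<open>p\<close>,
    from \<open>p\<close> to \<open>a\<close>, and from the width of the discrete boundary.\<close>
  moreover have "norm (m - l) < r + 3 * lM M"
    using m(2) pa a(2) norm_triangle_ineq[of "m - p" "p - a"] norm_triangle_ineq[of "m - a" "a - l"]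
    by (simp add: norm_minus_commute)
  ultimately show thesis
    using m(1) that by blast
qed

text \<open>Inside, the auxiliary ball is pushed strictly into the open ball; if there is no room for it, the
  origin serves as the lattice point.\<close>

lemma exists_lattice_inside_ball:
  assumes "l \<in> disc_boundary \<Lambda> (r + lM M) (ball 0 R)" "R > 0"
  obtains m where "m \<in> \<Lambda>" "m \<in> ball 0 R" "norm (l - m) < r + 3 * lM M"
proof -
  obtain a where a: "norm a = R" "norm (l - a) < r + lM M"
    using assms by (rule disc_boundary_ballE)
  \<comment> \<open>Half of the slack in the strict bound, so that a further move by
    \<open>\<delta>\<close> still leaves a strict bound.\<close>
  define \<delta> where "\<delta> = (r + lM M - norm (l - a)) / 2"
  have \<delta>: "\<delta> > 0" "norm (l - a) + \<delta> < r + lM M"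
    using a(2) by (auto simp: \<delta>_def field_simps)
  show thesis
  proof (cases "R \<le> lM M + \<delta>")
    case True
    \<comment> \<open>Here \<open>norm l \<le> norm (l - a) + R\<close>, which is below
      \<open>r + 2 * lM M\<close>.\<close>
    have "norm l < r + 3 * lM M"
      using True \<delta> a(1) norm_triangle_ineq[of "l - a" a] lM_nonneg by simp
    then show thesis
      using that[OF lattice_0] assms(2) by simp
  next
    case False
    define p where "p = (1 - (lM M + \<delta>) / R) *\<^sub>R a"
    have "norm p = \<bar>1 - (lM M + \<delta>) / R\<bar> * R"
      by (simp add: p_def a(1))
    also have "\<dots> = R - (lM M + \<delta>)"
      using False assms(2) by (simp add: abs_of_nonneg field_simps)
    finally have np: "norm p = R - (lM M + \<delta>)" .
    have "a - p = ((lM M + \<delta>) / R) *\<^sub>R a"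
      by (simp add: p_def algebra_simps)
    then have pa: "norm (a - p) = lM M + \<delta>"
      using a(1) assms(2) lM_nonneg \<delta>(1) by simp
    obtain m where m: "m \<in> \<Lambda>" "norm (p - m) \<le> lM M"
      by (rule lattice_point_near)
    have "m \<in> ball 0 R"
      using np m(2) \<delta>(1) norm_triangle_ineq2[of m p] by (simp add: norm_minus_commute)
    moreover have "norm (l - m) < r + 3 * lM M"
      using m(2) pa \<delta>(2) norm_triangle_ineq[of "l - a" "a - p"] norm_triangle_ineq[of "l - p" "p - m"]
      by simp
    ultimately show thesis
      using m(1) that by blast
  qed
qed

text \<open>Each boundary point is the inner end \<open>l\<close> or the outer end
  \<open>l + v\<close> of a short jump \<open>(v, l)\<close> out of the ball; the two kinds of ends
  account for the factor 2.\<close>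

lemma card_disc_boundary_ball_le:
  assumes "R > 0"
  shows "real (card (disc_boundary \<Lambda> (r + lM M) (ball 0 R)))
    \<le> 2 * (\<Sum>v\<in>\<Lambda> \<inter> ball 0 (r + 3 * lM M). real (card {l\<in>\<Lambda> \<inter> ball 0 R. l + v \<notin> ball 0 R}))"
proof -
  let ?D = "disc_boundary \<Lambda> (r + lM M) (ball 0 R)"
  let ?V = "\<Lambda> \<inter> ball 0 (r + 3 * lM M)"
  let ?L = "\<lambda>v. {l\<in>\<Lambda> \<inter> ball 0 R. l + v \<notin> ball 0 R}"
  let ?Q = "Sigma ?V ?L"
  have V: "finite ?V"
    by (intro finite_lattice_bounded bounded_ball)
  have L: "finite (?L v)" for v
    by (rule finite_subset[OF _ finite_lattice_bounded[OF bounded_ball[of 0 R]]]) auto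
  have Q: "finite ?Q"
    using V L by (rule finite_SigmaI)
  have "?D \<subseteq> snd ` ?Q \<union> (\<lambda>(v, l). l + v) ` ?Q"
  proof
    fix l assume l: "l \<in> ?D"
    then have l': "l \<in> \<Lambda>"
      by (simp add: disc_boundary_def)
    show "l \<in> snd ` ?Q \<union> (\<lambda>(v, l). l + v) ` ?Q"
    proof (cases "l \<in> ball 0 R")
      case True
      obtain m where m: "m \<in> \<Lambda>" "m \<notin> ball 0 R" "norm (m - l) < r + 3 * lM M"
        using l assms by (rule exists_lattice_outside_ball)
      then have "(m - l, l) \<in> ?Q"
        using True l' lattice_diff by auto
      then show ?thesis
        by (intro UnI1 image_eqI[where x = "(m - l, l)"]) auto
    next
      case False
      obtain m where m: "m \<in> \<Lambda>" "m \<in> ball 0 R" "norm (l - m) < r + 3 * lM M"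
        using l assms by (rule exists_lattice_inside_ball)
      then have "(l - m, m) \<in> ?Q"
        using False l' lattice_diff by auto
      then show ?thesis
        by (intro UnI2 image_eqI[where x = "(l - m, m)"]) auto
    qed
  qed
  then have "card ?D \<le> card (snd ` ?Q \<union> (\<lambda>(v, l). l + v) ` ?Q)"
    using Q by (intro card_mono) auto
  also have "\<dots> \<le> card (snd ` ?Q) + card ((\<lambda>(v, l). l + v) ` ?Q)"
    by (rule card_Un_le)
  also have "\<dots> \<le> 2 * card ?Q"
    using card_image_le[OF Q, of snd] card_image_le[OF Q, of "\<lambda>(v, l). l + v"] by linarith
  also have "card ?Q = (\<Sum>v\<in>?V. card (?L v))"
    using V L by simp
  finally have "real (card ?D) \<le> real (2 * (\<Sum>v\<in>?V. card (?L v)))"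
    by (rule of_nat_mono)
  then show ?thesis
    by simp
qed

end

section \<open>Constants and assembly of the two-sided estimate\<close>

theorem theorem1p3:
  fixes M :: "'n::finite phase \<Rightarrow> 'n phase"
    and g :: "real^'n \<Rightarrow> complex"
    and r C s :: real
  assumes "linear M" and "bij M"
    and "r > 0"
    and "g \<in> Mstar (lattice M)"
    and "tight_frame1 g (lattice M)"
    and "C > 0" and "s > 2 * real CARD('n) + 1"
    and "\<forall>z. cmod (stft g g z) \<le> C * (1 + norm z) powr (- s)"
    and "\<forall>l\<in>lattice M \<inter> ball 0 (r + 3 * lM M). stft g g l \<noteq> 0"
  shows "\<exists>C1 C2. C1 > 0 \<and> C2 > 0 \<and>
    (\<forall>R>0. \<forall>h ev. eigendecomp (gabor_mult g (lattice M) (ball 0 R)) h ev \<longrightarrow>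
       C1 * real (card (disc_boundary (lattice M) (r + lM M) (ball 0 R)))
         \<le> l1_norm (lattice M) (\<lambda>l. acc_spec g (lattice M) (ball 0 R) h l - indicator (ball 0 R) l)
       \<and> l1_norm (lattice M) (\<lambda>l. acc_spec g (lattice M) (ball 0 R) h l - indicator (ball 0 R) l)
         \<le> C2 * real (card (disc_boundary (lattice M) (r + lM M) (ball 0 R))))"
proof -
  interpret phase_lattice M
    by (rule phase_lattice.intro[OF assms(1,2)])
  have g: "g \<in> L2" and star: "(\<lambda>l. norm l * (cmod (stft g g l))^2) summable_on \<Lambda>"
    using assms(4) by (auto simp: Mstar_def)
  let ?F = "\<lambda>v. (cmod (stft g g v))^2"
  let ?V = "\<Lambda> \<inter> ball 0 (r + 3 * lM M)"
  let ?D = "\<lambda>R. real (card (disc_boundary \<Lambda> (r + lM M) (ball 0 R)))"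
  let ?err = "\<lambda>R h. l1_norm \<Lambda> (\<lambda>l. acc_spec g \<Lambda> (ball 0 R) h l - indicator (ball 0 R) l)"
  define b where "b = (norm_L2 g)^2"
  define K where "K = real (card (\<Lambda> \<inter> cball 0 (2 * (lM M + 1))))"
  define S where "S = (\<Sum>\<^sub>\<infinity>v\<in>\<Lambda>. ?F v * (norm v + 3))"
  define c where "c = Min (?F ` ?V)"
  have zero: "0 \<in> ?V"
    using lattice_0 lM_nonneg assms(3) by simp
  have V: "finite ?V"
    by (intro finite_lattice_bounded bounded_ball)
  \<comment> \<open>The nonvanishing hypothesis covers the origin, where the transform equals the
    squared norm of \<open>g\<close>.\<close>
  have norm_g: "norm_L2 g \<noteq> 0"
    using assms(9) zero stft_origin[of g] by fastforce
  have b: "b > 0"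
    using norm_g by (simp add: b_def)
  have c_le: "c \<le> ?F v" if "v \<in> ?V" for v
    unfolding c_def using V that by simp
  have "c \<in> ?F ` ?V"
    unfolding c_def using V zero by (intro Min_in) auto
  then have c: "c > 0"
    using assms(9) by auto
  \<comment> \<open>The frame identity for \<open>g\<close> itself sums \<open>?F\<close>, and
    membership in \<open>Mstar\<close> sums \<open>norm v * ?F v\<close>; together they make
    \<open>S\<close> a convergent series.\<close>
  have "?F summable_on \<Lambda>"
    using assms(5) g unfolding tight_frame1_def by (blast intro: has_sum_imp_summable)
  then have "(\<lambda>v. norm v * ?F v + 3 * ?F v) summable_on \<Lambda>"
    by (intro summable_on_add star summable_on_cmult_right)
  then have summable: "(\<lambda>v. ?F v * (norm v + 3)) summable_on \<Lambda>"
    by (simp add: algebra_simps)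
  have S: "S \<ge> 0"
    unfolding S_def by (intro infsum_nonneg) simp
  \<comment> \<open>The lower constant combines the factor 2 of
    \<open>card_disc_boundary_ball_le\<close> with \<open>spill \<le> b * err\<close>. The upper one
    comes from \<open>spill \<le> K * ?D R * S\<close> and from replacing 1 by \<open>?D R\<close>.
    Neither depends on \<open>R\<close>, \<open>h\<close> or \<open>ev\<close>.\<close>
  have bounds: "c / (2 * b) * ?D R \<le> ?err R h \<and> ?err R h \<le> (4 * K * S + 1) / b * ?D R"
    if R: "R > 0" and eig: "eigendecomp (gabor_mult g \<Lambda> (ball 0 R)) h ev" for R h ev
  proof -
    interpret gabor_eigen g \<Lambda> "ball 0 R" h ev
      by (rule gabor_eigen.intro[OF g norm_g assms(5) finite_lattice_bounded[OF bounded_ball] eig])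
    let ?L = "\<lambda>v. {l\<in>\<Lambda> \<inter> ball 0 R. l + v \<notin> ball 0 R}"
    note has_sum = spill_has_sum[OF lattice_add lattice_diff]
    have "c * (\<Sum>v\<in>?V. real (card (?L v))) \<le> (\<Sum>v\<in>?V. ?F v * real (card (?L v)))"
      unfolding sum_distrib_left by (intro sum_mono mult_right_mono c_le) auto
    also have "\<dots> \<le> spill"
      using has_sum V by (rule finite_sum_le_has_sum) auto
    finally have spill: "2 * (c * (\<Sum>v\<in>?V. real (card (?L v)))) \<le> 2 * spill"
      by simp
    have "c * ?D R \<le> c * (2 * (\<Sum>v\<in>?V. real (card (?L v))))"
      using c by (intro mult_left_mono card_disc_boundary_ball_le R) simp
    also have "\<dots> \<le> 2 * spill"
      using spill by (simp only: mult.left_commute)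
    also have "\<dots> \<le> 2 * (b * ?err R h)"
      using err_bounds(1) by (simp add: b_def)
    finally have lower: "c * ?D R \<le> ?err R h * (2 * b)"
      by (simp add: mult_ac)
    have "spill \<le> K * ?D R * S"
    proof (rule has_sum_mono[OF has_sum])
      show "((\<lambda>v. K * ?D R * (?F v * (norm v + 3))) has_sum K * ?D R * S) \<Lambda>"
        unfolding S_def by (intro has_sum_cmult_right has_sum_infsum summable)
      fix v
      show "?F v * real (card (?L v)) \<le> K * ?D R * (?F v * (norm v + 3))"
        using mult_left_mono[OF card_leaving_le[OF bounded_ball assms(3), of 0 R v], of "?F v"]
        by (simp add: K_def mult_ac)
    qed
    moreover have "1 \<le> ?D R"
      using disc_boundary_ball_nonempty[OF R assms(3)] by simp
    ultimately have "?err R h * b \<le> (4 * K * S + 1) * ?D R"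
      using err_bounds(2) by (simp add: b_def algebra_simps)
    with lower show ?thesis
      using b by (simp add: field_simps)
  qed
  show ?thesis
  proof (rule exI[of _ "c / (2 * b)"], rule exI[of _ "(4 * K * S + 1) / b"], intro conjI allI impI)
    show "c / (2 * b) > 0" "(4 * K * S + 1) / b > 0"
      using b c S by (auto simp: K_def intro!: divide_pos_pos add_nonneg_pos)
  qed (use bounds in blast)+
qed

end
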